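(* Let $(a,b)\in(\mathbb Q^2\setminus\mathbb Z^2)\cup\{(0,0)\}$. Then for all $\tau\in\mathbb H$ $$\theta_{a,b}^8(\tau)=e^{8\pi i(2ab+b)}\,q^{(1+2a)^2}\,\vartheta^8\bigl(\tau,(a+\tfrac12)\tau+b+\tfrac12\bigr).$$
   Context: Here $\mathbb H$ is the upper half-plane, $q^x=e^{2\pi i x\tau}$ for $x\in\mathbb Q$, $\zeta^x=e^{2\pi i xz}$. The theta-series with characteristic $(a,b)$ is $\vartheta_{a,b}(\tau,z)=\sum_{n\in\mathbb Z}e^{i\pi(n+a)^2\tau+2i\pi(n+a)(z+b)}$ and the theta-constant is $\theta_{a,b}(\tau)=\vartheta_{a,b}(\tau,0)$. The Jacobi theta-series is $\vartheta(\tau,z)=\sum_{n\in\mathbb Z}\bigl(\tfrac{-4}{n}\bigr)q^{n^2/8}\zeta^{n/2}$. *)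

theory Defs
  imports "HOL-Analysis.Analysis" "HOL-Number_Theory.Number_Theory"
begin

definition kronecker_prime :: "int \<Rightarrow> int \<Rightarrow> int" where
  "kronecker_prime a p =
     (if p = 2 then (if even a then 0 else if a mod 8 = 1 \<or> a mod 8 = 7 then 1 else - 1)
      else Legendre a p)"

(* The Kronecker symbol (a/n) for arbitrary integers a and n. For negative n,
   prime_factors still consists of positive primes, so (a/-1) is a separate factor. *)
definition kronecker :: "int \<Rightarrow> int \<Rightarrow> int" where
  "kronecker a n =
     (if n = 0 then (if \<bar>a\<bar> = 1 then 1 else 0)
      else (if n < 0 \<and> a < 0 then - 1 else 1) *
           (\<Prod>p\<in>prime_factors n. kronecker_prime a p ^ multiplicity p n))"

(* The nontrivial character modulo 4; kronecker_minus4 identifies it with (-4/n). *)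
definition chi4 :: "int \<Rightarrow> int" where
  "chi4 n = (if n mod 4 = 1 then 1 else if n mod 4 = 3 then - 1 else 0)"

lemma chi4_mult: "chi4 (m * n) = chi4 m * chi4 n"
proof -
  define r s where "r = m mod 4" and "s = n mod 4"
  have "r = 0 \<or> r = 1 \<or> r = 2 \<or> r = 3" "s = 0 \<or> s = 1 \<or> s = 2 \<or> s = 3"
    unfolding r_def s_def by presburger+
  moreover have "(m * n) mod 4 = (r * s) mod 4" unfolding r_def s_def by (simp add: mod_mult_eq)
  ultimately show ?thesis
    unfolding chi4_def r_def[symmetric] s_def[symmetric] by (elim disjE) simp_all
qed

lemma chi4_power: "chi4 (m ^ k) = chi4 m ^ k"
  by (induction k) (simp_all add: chi4_mult, simp add: chi4_def)

lemma chi4_prod: "chi4 (\<Prod>x\<in>A. f x) = (\<Prod>x\<in>A. chi4 (f x))"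
  by (induction A rule: infinite_finite_induct) (simp_all add: chi4_mult, simp_all add: chi4_def)

lemma kronecker_prime_minus4:
  assumes "prime (p::int)" shows "kronecker_prime (- 4) p = chi4 p"
proof (cases "p = 2")
  case False
  have p2: "p > 2" using assms False prime_ge_2_int[of p] by linarith
  have odd: "odd p" using assms p2 prime_odd_int by blast
  define k where "k = nat ((p - 1) div 2)"
  have k: "p = 2 * int k + 1" using odd p2 by (auto simp: k_def elim!: oddE)
  have pr: "prime (nat p)" using assms by simp
  have "[Legendre (- 4) (int (nat p)) = (- 4) ^ ((nat p - 1) div 2)] (mod int (nat p))"
    by (rule euler_criterion) (use pr p2 in auto)
  moreover have "(nat p - 1) div 2 = k" using k by auto
  ultimately have 1: "[Legendre (- 4) p = (- 4) ^ k] (mod p)" using p2 by simp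
  have "\<not> nat p dvd 2" using p2 by (auto dest: dvd_imp_le)
  then have "[2 ^ (nat p - 1) = 1] (mod nat p)" using fermat_theorem pr by blast
  then have "[int (2 ^ (nat p - 1)) = int 1] (mod int (nat p))" by (simp only: cong_int_iff)
  moreover have "nat p - 1 = 2 * k" using k by auto
  ultimately have "[2 ^ (2 * k) = 1] (mod p)" using p2 by simp
  then have "[(- 1) ^ k * 2 ^ (2 * k) = (- 1) ^ k * 1] (mod p)" by (rule cong_scalar_left)
  moreover have "(- 4) ^ k = (- 1) ^ k * (2::int) ^ (2 * k)"
    by (simp add: power_mult power_mult_distrib[symmetric])
  ultimately have 2: "[Legendre (- 4) p = (- 1) ^ k] (mod p)" using 1 cong_trans by fastforce
  have 3: "(- 1) ^ k = chi4 p"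
  proof (cases "even k")
    case True
    then have "p mod 4 = 1" unfolding k by presburger
    then show ?thesis using True by (simp add: chi4_def)
  next
    case False
    then have "p mod 4 = 3" unfolding k by presburger
    then show ?thesis using False by (simp add: chi4_def)
  qed
  have "p dvd (Legendre (- 4) p - chi4 p)" using 2 3 by (simp add: cong_iff_dvd_diff)
  moreover have "\<bar>Legendre (- 4) p - chi4 p\<bar> \<le> 2"
    by (auto simp: Legendre_def chi4_def)
  ultimately have "Legendre (- 4) p - chi4 p = 0"
    using p2 zdvd_not_zless[of "\<bar>Legendre (- 4) p - chi4 p\<bar>" p] by auto
  then show ?thesis using False by (simp add: kronecker_prime_def)
qed (simp add: kronecker_prime_def chi4_def)

lemma kronecker_minus4: "kronecker (- 4) n = chi4 n"
proof (cases "n = 0")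
  case False
  have "chi4 \<bar>n\<bar> = chi4 (\<Prod>p\<in>prime_factors n. p ^ multiplicity p n)"
    using False by (simp add: prod_prime_factors)
  also have "\<dots> = (\<Prod>p\<in>prime_factors n. kronecker_prime (- 4) p ^ multiplicity p n)"
    unfolding chi4_prod chi4_power
    by (intro prod.cong refl) (simp add: kronecker_prime_minus4 in_prime_factors_iff)
  finally have "kronecker (- 4) n = (if n < 0 then - 1 else 1) * chi4 \<bar>n\<bar>"
    using False by (simp add: kronecker_def)
  also have "\<dots> = chi4 n"
  proof (cases "n < 0")
    case True
    then show ?thesis using chi4_mult[of "- 1" "\<bar>n\<bar>"] by (simp add: chi4_def)
  qed simp
  finally show ?thesis .
qed (simp add: kronecker_def chi4_def)

(* q^x = e_pow tau x and zeta^x = e_pow z x, with no choice of branch involved. *)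
definition e_pow :: "complex \<Rightarrow> real \<Rightarrow> complex" where
  "e_pow w x = exp (2 * of_real pi * \<i> * of_real x * w)"

definition theta_char :: "real \<Rightarrow> real \<Rightarrow> complex \<Rightarrow> complex \<Rightarrow> complex" where
  "theta_char a b \<tau> z =
     (\<Sum>\<^sub>\<infinity>n\<in>(UNIV :: int set).
        exp (\<i> * of_real pi * (of_int n + of_real a)\<^sup>2 * \<tau>
             + 2 * \<i> * of_real pi * (of_int n + of_real a) * (z + of_real b)))"

definition theta_const :: "real \<Rightarrow> real \<Rightarrow> complex \<Rightarrow> complex" where
  "theta_const a b \<tau> = theta_char a b \<tau> 0"

definition jacobi_theta :: "complex \<Rightarrow> complex \<Rightarrow> complex" where
  "jacobi_theta \<tau> z =
     (\<Sum>\<^sub>\<infinity>n\<in>(UNIV :: int set).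
        of_int (kronecker (- 4) n) * e_pow \<tau> ((of_int n)\<^sup>2 / 8) * e_pow z (of_int n / 2))"

end

theory Submission
  imports Defs
begin

text \<open>
  The Jacobi theta-series is, up to the factor \<open>\<i>\<close>, the theta-series with characteristic
  \<open>(1/2, 1/2)\<close>: the symbol \<open>(-4/n)\<close> kills the even \<open>n\<close>, and for \<open>n = 2 * m + 1\<close> its value
  \<open>(-1) ^ m\<close> is what \<open>b = 1/2\<close> contributes to the phase (\<open>theta_char_half_half\<close>).
  Completing the square in the exponent turns a translation of \<open>z\<close> by \<open>c * \<tau> + d\<close> into a
  translation of the characteristic by \<open>(c, d)\<close>, at the price of an exponential factor
  (\<open>theta_char_translate\<close>). With \<open>c = a + 1/2\<close> and \<open>d = b + 1/2\<close> this leads from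
  \<open>(1/2, 1/2)\<close> to \<open>(a + 1, b + 1)\<close>, which differs from \<open>(a, b)\<close> by integers and so gives the
  same theta-constant up to the phase \<open>exp (2 * pi * \<i> * a)\<close>. The eighth power turns \<open>\<i>\<close>
  into 1 and the accumulated exponentials into the stated ones.

  Every step compares two series term by term, after a bijective change of the summation index
  and with a constant factor pulled out. Both operations are valid for \<open>infsum\<close> with its
  default value 0 for divergent series, so the comparison is purely termwise.
\<close>

lemma theta_char_translate:
  fixes a b c d :: real and \<tau> z :: complex
  shows "theta_char a b \<tau> (z + of_real c * \<tau> + of_real d) =
           exp (- (\<i> * of_real pi * (of_real c)\<^sup>2 * \<tau>)
                - 2 * \<i> * of_real pi * of_real c * (z + of_real b + of_real d))
           * theta_char (a + c) (b + d) \<tau> z"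
  unfolding theta_char_def infsum_cmult_right'[symmetric] exp_add[symmetric]
  by (intro infsum_cong arg_cong[where f = exp])
     (simp add: algebra_simps power2_eq_square)

lemma theta_char_periodic_fst: "theta_char (a + 1) b \<tau> z = theta_char a b \<tau> z"
proof -
  have "bij (\<lambda>n::int. n + 1)"
    by (rule bij_betw_byWitness[where f' = "\<lambda>n. n - 1"]) auto
  then show ?thesis
    unfolding theta_char_def
    by (subst infsum_reindex_bij_betw[symmetric, where g = "\<lambda>n::int. n + 1" and A = UNIV])
       (simp_all add: add_ac)
qed

lemma theta_char_quasiperiodic_snd:
  "theta_char a (b + 1) \<tau> z = exp (2 * \<i> * of_real pi * of_real a) * theta_char a b \<tau> z"
proof -
  have "exp (\<i> * of_real pi * (of_int n + of_real a)\<^sup>2 * \<tau>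
             + 2 * \<i> * of_real pi * (of_int n + of_real a) * (z + of_real (b + 1)))
      = exp (2 * \<i> * of_real pi * of_real a)
        * exp (\<i> * of_real pi * (of_int n + of_real a)\<^sup>2 * \<tau>
             + 2 * \<i> * of_real pi * (of_int n + of_real a) * (z + of_real b))" for n :: int
    unfolding exp_add[symmetric] exp_eq
    by (intro exI[of _ n]) (simp add: algebra_simps)
  then show ?thesis
    unfolding theta_char_def infsum_cmult_right'[symmetric] by simp
qed

lemma exp_pi_i_half_odd:
  fixes m :: int
  shows "exp (2 * \<i> * of_real pi * (of_int m + 1 / 2) * (1 / 2)) = \<i> * of_int (chi4 (2 * m + 1))"
proof (cases "even m")
  case True
  then obtain k where k: "m = 2 * k" by (elim evenE)
  have "exp (2 * \<i> * of_real pi * (of_int m + 1 / 2) * (1 / 2)) = exp (\<i> * of_real (pi / 2))"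
    unfolding exp_eq k by (intro exI[of _ k]) (simp add: algebra_simps)
  also have "\<dots> = \<i>"
    by (simp only: cis_conv_exp[symmetric] cis_pi_half)
  finally show ?thesis
    unfolding k chi4_def by simp
next
  case False
  then obtain k where k: "m = 2 * k + 1" by (elim oddE)
  have "exp (2 * \<i> * of_real pi * (of_int m + 1 / 2) * (1 / 2))
        = exp (\<i> * of_real pi + \<i> * of_real (pi / 2))"
    unfolding exp_eq k by (intro exI[of _ k]) (simp add: algebra_simps)
  also have "\<dots> = - \<i>"
    unfolding exp_add by (simp only: cis_conv_exp[symmetric] cis_pi_half cis_pi) simp
  finally show ?thesis
    unfolding k chi4_def by simp
qed

text \<open>
  Only odd \<open>n = 2 * m + 1\<close> contribute to the Jacobi theta-series, and then
  \<open>n\<^sup>2 / 8 = (m + 1/2)\<^sup>2 / 2\<close> and \<open>n / 2 = m + 1/2\<close> are the exponents of the characteristic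
  \<open>1/2\<close>.
\<close>

lemma theta_char_half_half: "theta_char (1/2) (1/2) \<tau> z = \<i> * jacobi_theta \<tau> z"
proof -
  let ?J = "\<lambda>n. of_int (chi4 n) * e_pow \<tau> ((of_int n)\<^sup>2 / 8) * e_pow z (of_int n / 2)"
  have "jacobi_theta \<tau> z = infsum ?J (range (\<lambda>m. 2 * m + 1))"
    unfolding jacobi_theta_def kronecker_minus4
  proof (rule infsum_cong_neutral)
    fix n :: int
    assume "n \<in> UNIV - range (\<lambda>m. 2 * m + 1)"
    then have "even n" by (metis DiffD2 oddE rangeI)
    then have "chi4 n = 0" unfolding chi4_def by presburger
    then show "?J n = 0" by simp
  qed auto
  also have "\<dots> = (\<Sum>\<^sub>\<infinity>m. ?J (2 * m + 1))"
    by (subst infsum_reindex) (auto intro!: injI simp: o_def)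
  finally have jacobi: "jacobi_theta \<tau> z = (\<Sum>\<^sub>\<infinity>m. ?J (2 * m + 1))" .
  have "exp (\<i> * of_real pi * (of_int m + of_real (1/2))\<^sup>2 * \<tau>
             + 2 * \<i> * of_real pi * (of_int m + of_real (1/2)) * (z + of_real (1/2)))
        = \<i> * ?J (2 * m + 1)" for m :: int
  proof -
    have "exp (\<i> * of_real pi * (of_int m + of_real (1/2))\<^sup>2 * \<tau>
               + 2 * \<i> * of_real pi * (of_int m + of_real (1/2)) * (z + of_real (1/2)))
          = exp (2 * \<i> * of_real pi * (of_int m + 1/2) * (1/2))
            * (e_pow \<tau> ((of_int (2 * m + 1))\<^sup>2 / 8) * e_pow z (of_int (2 * m + 1) / 2))"
      unfolding e_pow_def exp_add[symmetric]
      by (rule arg_cong[where f = exp]) (simp add: field_simps power2_eq_square)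
    then show ?thesis
      unfolding exp_pi_i_half_odd by (simp only: mult.assoc)
  qed
  then show ?thesis
    unfolding theta_char_def jacobi infsum_cmult_right'[symmetric] by simp
qed

theorem mainTheorem6:
  fixes a b :: real and \<tau> :: complex
  assumes "(a, b) \<in> (\<rat> \<times> \<rat> - \<int> \<times> \<int>) \<union> {(0, 0)}"
    and "Im \<tau> > 0"
  shows "theta_const a b \<tau> ^ 8 =
           exp (8 * of_real pi * \<i> * of_real (2 * a * b + b))
           * e_pow \<tau> ((1 + 2 * a)\<^sup>2)
           * jacobi_theta \<tau> ((of_real a + 1 / 2) * \<tau> + of_real b + 1 / 2) ^ 8"
proof -
  let ?J = "jacobi_theta \<tau> ((of_real a + 1 / 2) * \<tau> + of_real b + 1 / 2)"
  let ?u = "- (\<i> * of_real pi * (of_real (a + 1/2))\<^sup>2 * \<tau>)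
            - 2 * \<i> * of_real pi * of_real (a + 1/2) * (0 + of_real (1/2) + of_real (b + 1/2))"
  let ?v = "2 * \<i> * of_real pi * of_real a"
  let ?x = "8 * of_real pi * \<i> * of_real (2 * a * b + b)
            + 2 * of_real pi * \<i> * of_real ((1 + 2 * a)\<^sup>2) * \<tau>"
  have "\<i> * ?J = theta_char (1/2) (1/2) \<tau> (0 + of_real (a + 1/2) * \<tau> + of_real (b + 1/2))"
    unfolding theta_char_half_half by (simp add: add_ac)
  also have "\<dots> = exp ?u * theta_char (a + 1) (b + 1) \<tau> 0"
    unfolding theta_char_translate by (simp add: add_ac)
  also have "\<dots> = exp (?u + ?v) * theta_const a b \<tau>"
    unfolding theta_char_periodic_fst
    by (simp only: theta_char_quasiperiodic_snd theta_const_def exp_add mult.assoc)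
  finally have "(\<i> * ?J) ^ 8 = (exp (?u + ?v) * theta_const a b \<tau>) ^ 8"
    by simp
  moreover have "\<i> ^ 8 = 1"
    using power_mult[of \<i> 2 4] by simp
  ultimately have J8: "?J ^ 8 = exp (8 * (?u + ?v)) * theta_const a b \<tau> ^ 8"
    using exp_of_nat_mult[of 8 "?u + ?v"] by (simp add: power_mult_distrib)
  \<comment> \<open>The half-integers in \<open>?u\<close> leave behind only four full turns, \<open>- 8 * pi * \<i>\<close>.\<close>
  have "exp (?x + 8 * (?u + ?v)) = exp 0"
    unfolding exp_eq
    by (intro exI[of _ "-4"]) (simp add: field_simps power2_eq_square)
  then have "exp ?x * exp (8 * (?u + ?v)) = 1"
    unfolding exp_add[symmetric] by simp
  then have "theta_const a b \<tau> ^ 8 = exp ?x * ?J ^ 8"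
    unfolding J8 mult.assoc[symmetric] by simp
  then show ?thesis
    unfolding e_pow_def exp_add .
qed

end
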